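(* For $\epsilon$-machines, the Markov order equals the synchronization order: if $\mathcal{P}$ is a stationary process with finite-state $\epsilon$-machine $M$, $R$ is the Markov order of $\mathcal{P}$, and $k_{\mathbf S}$ is the synchronization order of $M$, then $R=k_{\mathbf S}$ (as elements of $\{0,1,2,\dots\}\cup\{\infty\}$).
   Context: A process is a stationary joint probability distribution over bi-infinite sequences $\dots X_{-1}X_0X_1\dots$ with values in a finite alphabet $\mathcal{A}$. Write $X_{a:b}=X_aX_{a+1}\cdots X_{b-1}$ (empty if $a=b$), $X_{:t}=\dots X_{t-2}X_{t-1}$ for the past of time $t$ and $X_{0:}=X_0X_1\dots$ for the future. The Markov order of the process is $R=\min\{\ell\ge 0 : \Pr(X_0\mid X_{-\ell:0})=\Pr(X_0\mid X_{:0})\text{ almost surely}\}$, with $R=\infty$ if no such finite $\ell$ exists. Two pasts are causally equivalent if they induce the same conditional distribution over futures. The causal state $\mathcal{S}_t$ at time $t$ is the equivalence class of the past $X_{:t}$. The $\epsilon$-machine of the process is the hidden Markov model whose states are the causal states (those with positive stationary probability) and whose labeled transition probabilities are $\Pr(X_0=x,\mathcal{S}_1=s'\mid \mathcal{S}_0=s)$. It is the minimal unifilar presentation of the process. The synchronization order of a presentation with internal state $\mathcal{S}_t$ (here, the causal state) is $k_{\mathbf S}=\min\{\ell\ge0: H[\mathcal{S}_\ell\mid X_{0:\ell}]=0\}$, where $H$ is Shannon conditional entropy, with $k_{\mathbf S}=\infty$ if no such finite $\ell$ exists. *)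

theory Defs
  imports "HOL-Probability.Probability" "HOL-Library.Extended_Nat"
begin

abbreviation seq_algebra :: "(nat \<Rightarrow> 'a::finite) measure" where
  "seq_algebra \<equiv> PiM UNIV (\<lambda>_. count_space UNIV)"

definition stationary_process :: "(int \<Rightarrow> 'a::finite) measure \<Rightarrow> bool" where
  "stationary_process P \<longleftrightarrow>
     prob_space P \<and>
     sets P = sets (PiM UNIV (\<lambda>_. count_space UNIV)) \<and>
     distr P P (\<lambda>\<omega> i. \<omega> (i + 1)) = P"

(* X_{a:b} = X_a ... X_{b-1}: the right end point is excluded. *)
definition block :: "int \<Rightarrow> int \<Rightarrow> (int \<Rightarrow> 'a) \<Rightarrow> 'a list" where
  "block a b \<omega> = map \<omega> [a..b - 1]"

(* Pasts are read backwards in time: entry 0 is the most recent symbol X_{t-1}. *)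
definition past :: "int \<Rightarrow> (int \<Rightarrow> 'a) \<Rightarrow> nat \<Rightarrow> 'a" where
  "past t \<omega> = (\<lambda>n. \<omega> (t - 1 - int n))"

definition future :: "int \<Rightarrow> (int \<Rightarrow> 'a) \<Rightarrow> nat \<Rightarrow> 'a" where
  "future t \<omega> = (\<lambda>n. \<omega> (t + int n))"

definition markov_at :: "(int \<Rightarrow> 'a::finite) measure \<Rightarrow> nat \<Rightarrow> bool" where
  "markov_at P l \<longleftrightarrow>
     (AE \<omega> in P. \<forall>x.
        real_cond_exp P (vimage_algebra (space P) (block (- int l) 0) (count_space UNIV))
          (indicator {\<omega>. \<omega> 0 = x}) \<omega> =
        real_cond_exp P (vimage_algebra (space P) (past 0) seq_algebra)
          (indicator {\<omega>. \<omega> 0 = x}) \<omega>)"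

(* The infimum of the empty set is \<infinity> in enat. *)
definition markov_order :: "(int \<Rightarrow> 'a::finite) measure \<Rightarrow> enat" where
  "markov_order P = (INF l\<in>{l. markov_at P l}. enat l)"

(* K is a regular conditional distribution of the future given the past.  Such a K is
   unique up to a null set of pasts; by stationarity the same K serves at every time t. *)
definition future_kernel ::
  "(int \<Rightarrow> 'a::finite) measure \<Rightarrow> ((nat \<Rightarrow> 'a) \<Rightarrow> (nat \<Rightarrow> 'a) measure) \<Rightarrow> bool" where
  "future_kernel P K \<longleftrightarrow>
     K \<in> measurable seq_algebra (prob_algebra seq_algebra) \<and>
     (\<forall>A \<in> sets seq_algebra. \<forall>B \<in> sets seq_algebra.
        emeasure P {\<omega> \<in> space P. past 0 \<omega> \<in> A \<and> future 0 \<omega> \<in> B} =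
        (\<integral>\<^sup>+\<omega>. emeasure (K (past 0 \<omega>)) B * indicator A (past 0 \<omega>) \<partial>P))"

definition causal_equiv ::
  "((nat \<Rightarrow> 'a) \<Rightarrow> (nat \<Rightarrow> 'a) measure) \<Rightarrow> (nat \<Rightarrow> 'a) rel" where
  "causal_equiv K = {(p, q). K p = K q}"

definition causal_state ::
  "((nat \<Rightarrow> 'a) \<Rightarrow> (nat \<Rightarrow> 'a) measure) \<Rightarrow> int \<Rightarrow> (int \<Rightarrow> 'a) \<Rightarrow> (nat \<Rightarrow> 'a) set" where
  "causal_state K t \<omega> = causal_equiv K `` {past t \<omega>}"

(* trans M s x s' is the probability of emitting x and moving to s', given state s. *)
record ('s, 'a) hmm =
  states :: "'s set"
  init :: "'s \<Rightarrow> real"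
  trans :: "'s \<Rightarrow> 'a \<Rightarrow> 's \<Rightarrow> real"

definition eps_machine ::
  "(int \<Rightarrow> 'a::finite) measure \<Rightarrow> ((nat \<Rightarrow> 'a) \<Rightarrow> (nat \<Rightarrow> 'a) measure) \<Rightarrow>
   ((nat \<Rightarrow> 'a) set, 'a) hmm" where
  "eps_machine P K =
     \<lparr> states = {s \<in> UNIV // causal_equiv K. 0 < \<P>(\<omega> in P. causal_state K 0 \<omega> = s)},
       init = (\<lambda>s. \<P>(\<omega> in P. causal_state K 0 \<omega> = s)),
       trans = (\<lambda>s x s'. \<P>(\<omega> in P. \<omega> 0 = x \<and> causal_state K 1 \<omega> = s' \<bar> causal_state K 0 \<omega> = s)) \<rparr>"

(* The second conjunct excludes processes whose causal states of positive probability,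
   though finite in number, do not carry all of the probability. *)
definition finite_state_eps_machine ::
  "(int \<Rightarrow> 'a::finite) measure \<Rightarrow> ((nat \<Rightarrow> 'a) \<Rightarrow> (nat \<Rightarrow> 'a) measure) \<Rightarrow> bool" where
  "finite_state_eps_machine P K \<longleftrightarrow>
     finite (states (eps_machine P K)) \<and>
     (AE \<omega> in P. causal_state K 0 \<omega> \<in> states (eps_machine P K))"

fun word_trans :: "('s, 'a) hmm \<Rightarrow> 's \<Rightarrow> 'a list \<Rightarrow> 's \<Rightarrow> real" where
  "word_trans M s [] s' = (if s = s' then 1 else 0)"
| "word_trans M s (x # w) s' = (\<Sum>u\<in>states M. trans M s x u * word_trans M u w s')"

(* The joint law of (X_{0:l}, S_l) when the hidden chain is started in init M. *)
definition word_state_law :: "('s, 'a) hmm \<Rightarrow> nat \<Rightarrow> ('a list \<times> 's) measure" where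
  "word_state_law M l =
     point_measure ({w. length w = l} \<times> states M)
       (\<lambda>(w, s'). ennreal (\<Sum>s\<in>states M. init M s * word_trans M s w s'))"

(* H[S_l | X_{0:l}] in bits. *)
definition state_uncertainty :: "('s, 'a) hmm \<Rightarrow> nat \<Rightarrow> real" where
  "state_uncertainty M l =
     prob_space.conditional_entropy (word_state_law M l) 2
       (count_space (states M)) (count_space {w. length w = l}) snd fst"

definition sync_order :: "('s, 'a) hmm \<Rightarrow> enat" where
  "sync_order M = (INF l\<in>{l. state_uncertainty M l = 0}. enat l)"

end

theory Submission imports Defs begin

text \<open>
  Conditionally on the current causal state \<open>s\<close>, the past and the future are independent, so a causal
  state \<open>v\<close> reached from \<open>s\<close> on the symbol \<open>x\<close> with positive probability has as its future law the
  future law of \<open>s\<close> conditioned on first emitting \<open>x\<close>.  Hence \<open>v\<close> is determined by \<open>s\<close> and \<open>x\<close>, and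
  by stationarity the word--state weights of the \<open>\<epsilon>\<close>-machine are the probabilities that
  \<open>X\<^bsub>-l:0\<^esub> = w\<close> and the current state is \<open>s\<close>.  The entropy vanishes at \<open>l\<close> exactly when every word \<open>w\<close>
  of length \<open>l\<close> admits at most one state.

  If it does, the law of the next symbol given the past depends on \<open>X\<^bsub>-l:0\<^esub>\<close> only, which is the Markov
  property of order \<open>l\<close>.  Conversely, if that property holds, two states admitted by the same word emit
  the next symbol with the same probabilities, and emitting \<open>x\<close> leads to two states that are
  again admitted by a common word of length \<open>l\<close>.  Iterating, the two states have the same future law
  and therefore coincide.
\<close>

section \<open>Cylinder sets and finite words\<close>

text \<open>The recursion peels off the first coordinate, which matches the emission of one symbol
  in later inductions.\<close>

primrec cyl :: "'a set list \<Rightarrow> (nat \<Rightarrow> 'a) set" where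
  "cyl [] = UNIV"
| "cyl (A # As) = {f. f 0 \<in> A \<and> f \<circ> Suc \<in> cyl As}"

lemma mem_cyl_iff: "f \<in> cyl As \<longleftrightarrow> (\<forall>i<length As. f i \<in> As ! i)"
  by (induction As arbitrary: f) (auto simp: less_Suc_eq_0_disj)

lemma space_seq_algebra [simp]: "space (seq_algebra :: (nat \<Rightarrow> 'a::finite) measure) = UNIV"
  by (simp add: space_PiM)

lemma UNIV_seq_algebra [simp]: "UNIV \<in> sets (seq_algebra :: (nat \<Rightarrow> 'a::finite) measure)"
  using sets.top[of "seq_algebra :: (nat \<Rightarrow> 'a) measure"] by simp

lemma measurable_seq_tail [measurable]:
  "(\<lambda>f. f \<circ> Suc) \<in> seq_algebra \<rightarrow>\<^sub>M (seq_algebra :: (nat \<Rightarrow> 'a::finite) measure)"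
  by (rule measurable_PiM_single') (auto simp: comp_def)

lemma sets_cyl [measurable]: "cyl As \<in> sets (seq_algebra :: (nat \<Rightarrow> 'a::finite) measure)"
proof (induction As)
  case Nil
  show ?case by simp
next
  case (Cons A As)
  note [measurable] = Cons
  have "{f \<in> space seq_algebra. f 0 \<in> A \<and> f \<circ> Suc \<in> cyl As} \<in> sets (seq_algebra :: (nat \<Rightarrow> 'a) measure)"
    by measurable
  then show ?case by simp
qed

text \<open>Head and tail of the list are jointly measurable because the product of two countable
  discrete spaces is again discrete.\<close>

lemma measurable_map_list:
  fixes f :: "'i \<Rightarrow> 'b \<Rightarrow> 'a::finite"
  assumes [measurable]: "\<And>i. f i \<in> M \<rightarrow>\<^sub>M count_space UNIV"
  shows "(\<lambda>\<omega>. map (\<lambda>i. f i \<omega>) xs) \<in> M \<rightarrow>\<^sub>M count_space UNIV"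
proof (induction xs)
  case (Cons x xs)
  note [measurable] = Cons
  have "(\<lambda>\<omega>. (f x \<omega>, map (\<lambda>i. f i \<omega>) xs)) \<in> M \<rightarrow>\<^sub>M count_space UNIV \<Otimes>\<^sub>M count_space UNIV"
    by measurable
  then have "(\<lambda>\<omega>. (f x \<omega>, map (\<lambda>i. f i \<omega>) xs)) \<in> M \<rightarrow>\<^sub>M count_space UNIV"
    by (simp add: pair_measure_countable)
  from measurable_compose[OF this, of "\<lambda>(y, ys). y # ys"] show ?case by simp
qed simp

text \<open>A discrete Doob-Dynkin lemma: events of the generated algebra are unions of fibres of
  \<open>b\<close>, so \<open>f\<close> cannot separate two points of one fibre. Choosing a point in
  each fibre gives \<open>h\<close>.\<close>

lemma vimage_algebra_count_space_factor:
  fixes f :: "'a \<Rightarrow> real"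
  assumes "f \<in> borel_measurable (vimage_algebra UNIV b (count_space UNIV))"
  shows "\<exists>h. \<forall>x. f x = h (b x)"
proof -
  have eq: "f x = f y" if "b x = b y" for x y
  proof -
    have "f -` {f x} \<in> sets (vimage_algebra UNIV b (count_space UNIV))"
      using measurable_sets[OF assms, of "{f x}"] by simp
    then obtain C where "f -` {f x} = b -` C"
      by (auto simp: sets_vimage_algebra2)
    then have "y \<in> f -` {f x}" using that by (metis vimageE vimageI singletonI)
    then show ?thesis by simp
  qed
  have "\<forall>x. f x = (\<lambda>w. f (SOME y. b y = w)) (b x)"
    using eq by (metis (mono_tags, lifting) someI)
  then show ?thesis by (intro exI[of _ "\<lambda>w. f (SOME y. b y = w)"])
qed

section \<open>Vanishing conditional entropy of a finite joint law\<close>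

text \<open>With \<open>r\<close> the marginal on \<open>A\<close>, the entropy is a sum of
  nonnegative terms \<open>- q * log 2 (q / r)\<close>. Such a term vanishes only if
  \<open>q\<close> is zero or all of \<open>r\<close>, so the entropy is zero exactly when each
  \<open>w\<close> puts its mass on at most one \<open>s\<close>.\<close>

lemma conditional_entropy_eq_0_iff:
  fixes q :: "'a \<times> 'b \<Rightarrow> real"
  assumes A: "finite A" "A \<noteq> {}" and B: "finite B" "B \<noteq> {}"
    and nonneg: "\<And>z. z \<in> A \<times> B \<Longrightarrow> 0 \<le> q z" and sum1: "(\<Sum>z\<in>A \<times> B. q z) = 1"
  shows "prob_space.conditional_entropy (point_measure (A \<times> B) (\<lambda>z. ennreal (q z))) 2
      (count_space B) (count_space A) snd fst = 0 \<longleftrightarrow>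
    (\<forall>w\<in>A. \<forall>s\<in>B. \<forall>s'\<in>B. 0 < q (w, s) \<longrightarrow> 0 < q (w, s') \<longrightarrow> s = s')"
proof -
  define M where "M = point_measure (A \<times> B) (\<lambda>z. ennreal (q z))"
  have sp: "space M = A \<times> B" by (simp add: M_def space_point_measure)
  have em: "emeasure M X = ennreal (\<Sum>z\<in>X. q z)" if "X \<subseteq> A \<times> B" for X
    using that A B nonneg unfolding M_def
    by (subst emeasure_point_measure_finite) (auto intro!: sum_ennreal)
  have me: "measure M X = (\<Sum>z\<in>X. q z)" if "X \<subseteq> A \<times> B" for X
    using em[OF that] that nonneg
    by (subst measure_def) (simp, intro enn2real_ennreal sum_nonneg, blast)
  interpret prob_space M
    by (rule prob_spaceI) (use em[of "A \<times> B"] sp sum1 in simp)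
  interpret information_space M 2
    by unfold_locales simp
  define r where "r w = (\<Sum>s\<in>B. q (w, s))" for w
  define t where "t z = q (snd z, fst z) * log 2 (q (snd z, fst z) / r (snd z))" for z
  have img: "snd ` space M = B" "fst ` space M = A"
    "(\<lambda>z. (snd z, fst z)) ` space M = B \<times> A"
    using A B by (auto simp: sp image_iff)
  have Py: "prob (fst -` {w} \<inter> space M) = r w" if "w \<in> A" for w
  proof -
    have "fst -` {w} \<inter> space M = Pair w ` B" using that by (auto simp: sp)
    moreover have "Pair w ` B \<subseteq> A \<times> B" using that by auto
    ultimately show ?thesis
      by (simp add: me r_def sum.reindex inj_on_def)
  qed
  have Pxy: "prob ((\<lambda>z. (snd z, fst z)) -` {(s, w)} \<inter> space M) = q (w, s)" if "w \<in> A" "s \<in> B" for s w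
  proof -
    have "(\<lambda>z. (snd z, fst z)) -` {(s, w)} \<inter> space M = {(w, s)}" using that by (auto simp: sp)
    then show ?thesis using that by (simp add: me)
  qed
  have sd1: "simple_distributed M fst (\<lambda>w. prob (fst -` {w} \<inter> space M))"
    by (rule simple_distributedI[OF _ _ refl]) (use A B in \<open>simp_all add: M_def\<close>)
  have sd2: "simple_distributed M (\<lambda>z. (snd z, fst z)) (\<lambda>y. prob ((\<lambda>z. (snd z, fst z)) -` {y} \<inter> space M))"
    by (rule simple_distributedI[OF _ _ refl]) (use A B in \<open>simp_all add: M_def\<close>)
  have "conditional_entropy 2 (count_space B) (count_space A) snd fst =
      - (\<Sum>(s, w)\<in>B \<times> A. prob ((\<lambda>z. (snd z, fst z)) -` {(s, w)} \<inter> space M) *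
        log 2 (prob ((\<lambda>z. (snd z, fst z)) -` {(s, w)} \<inter> space M) / prob (fst -` {w} \<inter> space M)))"
    using conditional_entropy_eq[OF sd1 sd2] by (simp only: img)
  also have "\<dots> = (\<Sum>z\<in>B \<times> A. - t z)"
    unfolding sum_negf by (intro arg_cong[where f = uminus] sum.cong) (auto simp: Pxy Py t_def)
  finally have H: "conditional_entropy 2 (count_space B) (count_space A) snd fst = (\<Sum>z\<in>B \<times> A. - t z)" .
  have qr: "q (w, s) \<le> r w" if "w \<in> A" "s \<in> B" for w s
    unfolding r_def using that B nonneg by (intro member_le_sum) auto
  have t: "t (s, w) \<le> 0 \<and> (t (s, w) = 0 \<longleftrightarrow> q (w, s) = 0 \<or> q (w, s) = r w)" if "w \<in> A" "s \<in> B" for w s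
  proof (cases "q (w, s) = 0")
    case False
    then have "0 < q (w, s)" using nonneg[of "(w, s)"] that by simp
    show ?thesis
    proof (cases "q (w, s) = r w")
      case True
      then show ?thesis by (simp add: t_def)
    next
      case neq: False
      then have "q (w, s) / r w < 1" "0 < q (w, s) / r w"
        using qr[OF that] \<open>0 < q (w, s)\<close> by auto
      then have "log 2 (q (w, s) / r w) < 0" by simp
      then have "t (s, w) < 0"
        using \<open>0 < q (w, s)\<close> by (simp add: t_def mult_pos_neg)
      then show ?thesis using neq False by simp
    qed
  qed (simp add: t_def)
  have "(\<Sum>z\<in>B \<times> A. - t z) = 0 \<longleftrightarrow> (\<forall>z\<in>B \<times> A. - t z = 0)"
    using A B t by (intro sum_nonneg_eq_0_iff) auto
  also have "\<dots> \<longleftrightarrow> (\<forall>w\<in>A. \<forall>s\<in>B. q (w, s) = 0 \<or> q (w, s) = r w)"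
    using t by auto
  also have "\<dots> \<longleftrightarrow> (\<forall>w\<in>A. \<forall>s\<in>B. \<forall>s'\<in>B. 0 < q (w, s) \<longrightarrow> 0 < q (w, s') \<longrightarrow> s = s')"
  proof (intro iffI ballI impI)
    fix w s s'
    assume *: "\<forall>w\<in>A. \<forall>s\<in>B. q (w, s) = 0 \<or> q (w, s) = r w" "w \<in> A" "s \<in> B" "s' \<in> B"
      "0 < q (w, s)" "0 < q (w, s')"
    show "s = s'"
    \<comment> \<open>Two distinct states of positive weight would each carry the whole marginal,
      yet their sum is bounded by it.\<close>
    proof (rule ccontr)
      assume "s \<noteq> s'"
      then have "q (w, s) + q (w, s') = (\<Sum>u\<in>{s, s'}. q (w, u))" by simp
      also have "\<dots> \<le> r w"
        unfolding r_def using * B nonneg by (intro sum_mono2) auto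
      finally show False using * by force
    qed
  next
    fix w s
    assume *: "\<forall>w\<in>A. \<forall>s\<in>B. \<forall>s'\<in>B. 0 < q (w, s) \<longrightarrow> 0 < q (w, s') \<longrightarrow> s = s'" "w \<in> A" "s \<in> B"
    show "q (w, s) = 0 \<or> q (w, s) = r w"
    proof (cases "q (w, s) = 0")
      case False
      then have pos: "0 < q (w, s)" using nonneg[of "(w, s)"] * by simp
      have "q (w, u) = 0" if "u \<in> B - {s}" for u
        using that * pos nonneg[of "(w, u)"] by force
      then have "r w = q (w, s)"
        unfolding r_def using * B by (simp add: sum.remove)
      then show ?thesis by simp
    qed simp
  qed
  finally show ?thesis using H by (simp add: M_def)
qed

section \<open>Laws of sequences and cylinder probabilities\<close>

text \<open>The set \<open>J\<close> is bounded; coordinates below the bound but outside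
  \<open>J\<close> are padded with \<open>UNIV\<close>.\<close>

lemma prod_emb_eq_cyl:
  fixes A :: "nat \<Rightarrow> 'a::finite set"
  assumes "finite J"
  shows "\<exists>As. prod_emb UNIV (\<lambda>_. count_space UNIV) J (Pi\<^sub>E J A) = cyl As"
proof -
  obtain n where n: "\<And>j. j \<in> J \<Longrightarrow> j < n"
    using assms finite_nat_set_iff_bounded by metis
  define As where "As = map (\<lambda>i. if i \<in> J then A i else UNIV) [0..<n]"
  have "prod_emb UNIV (\<lambda>_. count_space UNIV) J (Pi\<^sub>E J A) = cyl As"
    using n by (auto simp: prod_emb_def PiE_iff mem_cyl_iff As_def split: if_splits)
  then show ?thesis ..
qed

text \<open>Cylinders include all finite-dimensional boxes, an intersection-stable generator of the
  product algebra.\<close>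

lemma measure_eqI_cyl:
  fixes M N :: "(nat \<Rightarrow> 'a::finite) measure"
  assumes "prob_space M" "prob_space N" "sets M = sets seq_algebra" "sets N = sets seq_algebra"
    and "\<And>As. measure M (cyl As) = measure N (cyl As)"
  shows "M = N"
proof (rule measure_eqI_PiM_infinite[OF assms(3,4)])
  interpret M: prob_space M by fact
  interpret N: prob_space N by fact
  show "finite_measure M" by unfold_locales
  fix A :: "nat \<Rightarrow> 'a set" and J :: "nat set"
  assume "finite J"
  then obtain As where "prod_emb UNIV (\<lambda>_. count_space UNIV) J (Pi\<^sub>E J A) = cyl As"
    using prod_emb_eq_cyl by blast
  then show "emeasure M (prod_emb UNIV (\<lambda>_. count_space UNIV) J (Pi\<^sub>E J A)) =
    emeasure N (prod_emb UNIV (\<lambda>_. count_space UNIV) J (Pi\<^sub>E J A))"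
    by (simp add: M.emeasure_eq_measure N.emeasure_eq_measure assms(5))
qed

section \<open>Pasts, futures and words under the time shift\<close>

abbreviation (input) time_shift :: "nat \<Rightarrow> (int \<Rightarrow> 'a) \<Rightarrow> int \<Rightarrow> 'a" where
  "time_shift n \<omega> \<equiv> \<lambda>i. \<omega> (i + int n)"

lemma past_shift: "past t (time_shift n \<omega>) = past (t + int n) \<omega>"
  by (simp add: past_def algebra_simps)

lemma future_shift: "future t (time_shift n \<omega>) = future (t + int n) \<omega>"
  by (simp add: future_def algebra_simps)

lemma past_1: "past 1 \<omega> = case_nat (\<omega> 0) (past 0 \<omega>)"
  by (auto simp: past_def fun_eq_iff algebra_simps split: nat.split)

lemma future_1: "future 1 \<omega> = future 0 \<omega> \<circ> Suc"
  by (auto simp: future_def fun_eq_iff)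

lemma block_Cons: "block 0 (int (Suc n)) \<omega> = \<omega> 0 # block 0 (int n) (time_shift 1 \<omega>)"
proof -
  have "[0..int n] = 0 # map (\<lambda>i. i + 1) [0..int n - 1]"
    by (rule nth_equalityI) (auto simp: nth_Cons split: nat.split)
  then show ?thesis by (simp add: block_def comp_def)
qed

text \<open>The reversal is due to pasts being read backwards, whereas words are
  chronological.\<close>

lemma block_past: "block (- int l) 0 \<omega> = map (past 0 \<omega>) (rev [0..<l])"
  by (rule nth_equalityI) (auto simp: block_def past_def rev_nth)

lemma block_shift: "block a b (time_shift n \<omega>) = block (a + int n) (b + int n) \<omega>"
  by (rule nth_equalityI) (auto simp: block_def algebra_simps)

text \<open>The newest symbol is appended before the oldest is dropped, so that \<open>l = 0\<close>
  yields the empty word on both sides.\<close>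

lemma block_slide: "block (1 - int l) 1 \<omega> = tl (block (- int l) 0 \<omega> @ [\<omega> 0])"
proof (rule nth_equalityI)
  fix i assume "i < length (block (1 - int l) 1 \<omega>)"
  then have "i < l" by (simp add: block_def)
  then consider "i < l - 1" | "int i = int l - 1" by linarith
  then show "block (1 - int l) 1 \<omega> ! i = tl (block (- int l) 0 \<omega> @ [\<omega> 0]) ! i"
    using \<open>i < l\<close> by cases (auto simp: block_def nth_tl nth_append algebra_simps)
qed (simp add: block_def)

lemma length_block [simp]: "length (block a b \<omega>) = nat (b - a)"
  by (simp add: block_def)

section \<open>Stationarity\<close>

locale causal_process =
  fixes P :: "(int \<Rightarrow> 'a::finite) measure" and K :: "(nat \<Rightarrow> 'a) \<Rightarrow> (nat \<Rightarrow> 'a) measure"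
  assumes stationary: "stationary_process P"
    and kernel: "future_kernel P K"
    and finite_eps_machine: "finite_state_eps_machine P K"
begin

sublocale prob_space P
  using stationary by (simp add: stationary_process_def)

lemma sets_P [measurable_cong]: "sets P = sets (PiM UNIV (\<lambda>_. count_space UNIV))"
  using stationary by (simp add: stationary_process_def)

lemma space_P [simp]: "space P = UNIV"
  using sets_eq_imp_space_eq[OF sets_P] by (simp add: space_PiM)

lemma measurable_past [measurable]: "past t \<in> P \<rightarrow>\<^sub>M seq_algebra"
  unfolding past_def by (rule measurable_PiM_single') auto

lemma measurable_future [measurable]: "future t \<in> P \<rightarrow>\<^sub>M seq_algebra"
  unfolding future_def by (rule measurable_PiM_single') auto

lemma measurable_block [measurable]: "block a b \<in> P \<rightarrow>\<^sub>M count_space UNIV"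
proof -
  have "(\<lambda>\<omega>. map \<omega> xs) \<in> P \<rightarrow>\<^sub>M count_space UNIV" for xs
    by (rule measurable_map_list) measurable
  then show ?thesis unfolding block_def .
qed

lemma measurable_shift [measurable]: "time_shift n \<in> P \<rightarrow>\<^sub>M P"
  by (subst measurable_cong_sets[OF refl sets_P], rule measurable_PiM_single') auto

lemma distr_shift: "distr P P (time_shift n) = P"
proof (induction n)
  case 0
  show ?case by simp
next
  case (Suc n)
  have "distr P P (time_shift (Suc n)) = distr P P (time_shift n \<circ> time_shift 1)"
    by (simp add: comp_def algebra_simps)
  also have "\<dots> = distr (distr P P (time_shift 1)) P (time_shift n)"
    by (rule distr_distr[symmetric]) measurable
  also have "\<dots> = P"
    using stationary Suc by (simp add: stationary_process_def)
  finally show ?case .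
qed

lemma prob_shift:
  assumes [measurable]: "Measurable.pred P Q"
  shows "\<P>(\<omega> in P. Q (time_shift n \<omega>)) = \<P>(\<omega> in P. Q \<omega>)"
proof -
  have "\<P>(\<omega> in P. Q \<omega>) = \<P>(\<omega> in distr P P (time_shift n). Q \<omega>)"
    by (simp add: distr_shift)
  also have "\<dots> = \<P>(\<omega> in P. Q (time_shift n \<omega>))"
    using predE[OF assms] by (subst measure_distr) (auto simp: vimage_def)
  finally show ?thesis ..
qed

lemma prob_Collect_mono:
  assumes "Measurable.pred P R" and "\<And>\<omega>. Q \<omega> \<Longrightarrow> R \<omega>"
  shows "\<P>(\<omega> in P. Q \<omega>) \<le> \<P>(\<omega> in P. R \<omega>)"
  using predE[OF assms(1)] assms(2) by (intro finite_measure_mono) auto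

lemma prob_Collect_eq_0_iff:
  "Measurable.pred P Q \<Longrightarrow> \<P>(\<omega> in P. Q \<omega>) = 0 \<longleftrightarrow> (AE \<omega> in P. \<not> Q \<omega>)"
  by (intro prob_Collect_eq_0 predE)

lemma AE_shift:
  assumes "AE \<omega> in P. Q \<omega>"
  shows "AE \<omega> in P. Q (time_shift n \<omega>)"
proof (rule AE_distrD[of "time_shift n" P P Q])
  show "AE \<omega> in distr P P (time_shift n). Q \<omega>"
    unfolding distr_shift by (rule assms)
qed measurable

section \<open>Causal states and their future laws\<close>

definition causal_states :: "(nat \<Rightarrow> 'a) set set" where
  "causal_states = states (eps_machine P K)"

text \<open>\<open>K\<close> is constant on a causal state, so the choice of the representative is
  immaterial.\<close>

definition state_law :: "(nat \<Rightarrow> 'a) set \<Rightarrow> (nat \<Rightarrow> 'a) measure" where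
  "state_law s = K (SOME p. p \<in> s)"

lemma kernel_measurable [measurable]: "K \<in> seq_algebra \<rightarrow>\<^sub>M prob_algebra seq_algebra"
  using kernel by (simp add: future_kernel_def)

lemma sets_kernel [simp]: "sets (K p) = sets seq_algebra"
  and prob_space_kernel: "prob_space (K p)"
  using measurable_space[OF kernel_measurable, of p] by (auto simp: space_prob_algebra)

lemma space_kernel [simp]: "space (K p) = UNIV"
  using sets_eq_imp_space_eq[OF sets_kernel] by simp

lemma causal_state_eq_iff: "s \<in> UNIV // causal_equiv K \<Longrightarrow> causal_state K t \<omega> = s \<longleftrightarrow> past t \<omega> \<in> s"
  by (auto simp: causal_state_def quotient_def causal_equiv_def)

lemma causal_classI: "s \<in> causal_states \<Longrightarrow> s \<in> UNIV // causal_equiv K"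
  by (simp add: causal_states_def eps_machine_def)

lemma causal_state_iff: "s \<in> causal_states \<Longrightarrow> causal_state K t \<omega> = s \<longleftrightarrow> past t \<omega> \<in> s"
  by (simp add: causal_state_eq_iff causal_classI)

lemma kernel_state:
  assumes "s \<in> causal_states" "p \<in> s"
  shows "K p = state_law s"
proof -
  have "(SOME p. p \<in> s) \<in> s" by (rule someI[of "\<lambda>p. p \<in> s", OF assms(2)])
  then show ?thesis
    using causal_classI[OF assms(1)] assms(2)
    by (auto simp: quotient_def causal_equiv_def state_law_def)
qed

lemma state_nonempty: "s \<in> causal_states \<Longrightarrow> s \<noteq> {}"
  using causal_classI by (auto simp: quotient_def causal_equiv_def)

lemma state_law_kernel: "s \<in> causal_states \<Longrightarrow> \<exists>p\<in>s. state_law s = K p"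
  using state_nonempty kernel_state by (metis ex_in_conv)

lemma state_eqI:
  assumes "s \<in> causal_states" "s' \<in> causal_states" "state_law s = state_law s'"
  shows "s = s'"
proof -
  obtain p p' where "p \<in> s" "p' \<in> s'" "K p = K p'"
    using assms state_law_kernel by metis
  then show ?thesis
    using causal_classI[OF assms(1)] causal_classI[OF assms(2)]
    by (auto simp: quotient_def causal_equiv_def)
qed

lemma states_disjoint: "\<lbrakk>s \<in> causal_states; s' \<in> causal_states; p \<in> s; p \<in> s'\<rbrakk> \<Longrightarrow> s = s'"
  using kernel_state state_eqI by metis

text \<open>Equality with a fixed law \<open>K p\<close> is decided by the cylinder probabilities.
  There are only countably many cylinders over a finite alphabet, and each probability is measurable
  in the past.\<close>

lemma state_measurable [measurable]:
  assumes "s \<in> causal_states"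
  shows "s \<in> sets seq_algebra"
proof -
  obtain p where p: "s = {q. K p = K q}"
    using causal_classI[OF assms] by (auto simp: quotient_def causal_equiv_def)
  have "s = {q \<in> space seq_algebra. \<forall>As. measure (K q) (cyl As) = measure (K p) (cyl As)}"
  proof -
    have "K p = K q" if "\<forall>As. measure (K q) (cyl As) = measure (K p) (cyl As)" for q
      by (rule measure_eqI_cyl) (simp_all add: that prob_space_kernel)
    then show ?thesis unfolding p by auto
  qed
  also have "\<dots> \<in> sets seq_algebra" by measurable
  finally show ?thesis .
qed

lemma finite_causal_states [simp]: "finite causal_states"
  using finite_eps_machine by (simp add: finite_state_eps_machine_def causal_states_def)

lemma prob_state_pos:
  assumes "s \<in> causal_states"
  shows "\<P>(\<omega> in P. past 0 \<omega> \<in> s) > 0"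
proof -
  have "\<P>(\<omega> in P. causal_state K 0 \<omega> = s) > 0"
    using assms by (simp add: causal_states_def eps_machine_def)
  then show ?thesis by (simp only: causal_state_iff[OF assms])
qed

text \<open>Finiteness of the machine includes that its states carry all the mass at time 0;
  stationarity moves this to time \<open>n\<close>.\<close>

lemma AE_past_state: "AE \<omega> in P. \<exists>s\<in>causal_states. past (int n) \<omega> \<in> s"
proof -
  have "AE \<omega> in P. \<exists>s\<in>causal_states. past 0 \<omega> \<in> s"
    using finite_eps_machine[unfolded finite_state_eps_machine_def, folded causal_states_def, THEN conjunct2]
    by eventually_elim (metis causal_state_iff)
  from AE_shift[OF this, of n] show ?thesis by (simp add: past_shift)
qed

text \<open>Total probability over the state at time \<open>n\<close>: distinct states are disjoint
  and together they cover almost every past.\<close>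

lemma prob_states_sum:
  assumes [measurable]: "Measurable.pred P Q"
  shows "\<P>(\<omega> in P. Q \<omega>) = (\<Sum>s\<in>causal_states. \<P>(\<omega> in P. Q \<omega> \<and> past (int n) \<omega> \<in> s))"
proof (rule prob_sum)
  show "AE \<omega> in P. (\<forall>s\<in>causal_states. Q \<omega> \<and> past (int n) \<omega> \<in> s \<longrightarrow> Q \<omega>) \<and>
      (Q \<omega> \<longrightarrow> (\<exists>!s\<in>causal_states. Q \<omega> \<and> past (int n) \<omega> \<in> s))"
    using AE_past_state[of n] by eventually_elim (blast dest: states_disjoint)
  fix s assume "s \<in> causal_states"
  note [measurable] = this
  show "{\<omega> \<in> space P. Q \<omega> \<and> past (int n) \<omega> \<in> s} \<in> events" by measurable
qed (simp, measurable)

section \<open>Independence of past and future given the causal state\<close>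

text \<open>On \<open>A\<close> the kernel is the constant \<open>state_law s\<close> and leaves the
  integral. Allowing any measurable part \<open>A\<close> of the state, rather than only
  \<open>s\<close>, expresses conditional independence.\<close>

lemma prob_past_future:
  assumes s: "s \<in> causal_states" and A [measurable]: "A \<in> sets seq_algebra" and "A \<subseteq> s"
    and B [measurable]: "B \<in> sets seq_algebra"
  shows "\<P>(\<omega> in P. past 0 \<omega> \<in> A \<and> future 0 \<omega> \<in> B) = \<P>(\<omega> in P. past 0 \<omega> \<in> A) * measure (state_law s) B"
proof -
  have "emeasure P {\<omega> \<in> space P. past 0 \<omega> \<in> A \<and> future 0 \<omega> \<in> B} =
      (\<integral>\<^sup>+\<omega>. emeasure (K (past 0 \<omega>)) B * indicator A (past 0 \<omega>) \<partial>P)"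
    using kernel by (simp add: future_kernel_def)
  also have "\<dots> = (\<integral>\<^sup>+\<omega>. emeasure (state_law s) B * indicator {\<omega>\<in>space P. past 0 \<omega> \<in> A} \<omega> \<partial>P)"
    using kernel_state[OF s] \<open>A \<subseteq> s\<close> by (intro nn_integral_cong) (auto simp: indicator_def)
  also have "\<dots> = emeasure (state_law s) B * emeasure P {\<omega>\<in>space P. past 0 \<omega> \<in> A}"
    by (rule nn_integral_cmult_indicator) measurable
  finally show ?thesis
    unfolding measure_def by (simp only: enn2real_mult mult.commute)
qed

lemma prob_space_state_law: "s \<in> causal_states \<Longrightarrow> prob_space (state_law s)"
  and sets_state_law [simp]: "sets (state_law s) = sets seq_algebra"
  by (simp_all add: state_law_def prob_space_kernel)

lemma space_state_law [simp]: "space (state_law s) = UNIV"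
  by (simp add: state_law_def)

lemma prob_past_future_at:
  assumes "s \<in> causal_states" and A [measurable]: "A \<in> sets seq_algebra" and "A \<subseteq> s"
    and B [measurable]: "B \<in> sets seq_algebra"
  shows "\<P>(\<omega> in P. past (int n) \<omega> \<in> A \<and> future (int n) \<omega> \<in> B) =
    \<P>(\<omega> in P. past (int n) \<omega> \<in> A) * measure (state_law s) B"
  using prob_shift[of "\<lambda>\<omega>. past 0 \<omega> \<in> A \<and> future 0 \<omega> \<in> B" n]
    prob_shift[of "\<lambda>\<omega>. past 0 \<omega> \<in> A" n] prob_past_future[OF assms]
  by (simp add: past_shift future_shift)

text \<open>Used for pasts, where prefixing \<open>x\<close> appends the newest symbol, as well as for futures.\<close>

definition glue :: "(nat \<Rightarrow> 'a) set \<Rightarrow> 'a \<Rightarrow> (nat \<Rightarrow> 'a) set \<Rightarrow> (nat \<Rightarrow> 'a) set" where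
  "glue A x v = {q. q \<circ> Suc \<in> A \<and> q 0 = x \<and> q \<in> v}"

lemma sets_glue [measurable]:
  assumes [measurable]: "A \<in> sets seq_algebra" "v \<in> sets seq_algebra"
  shows "glue A x v \<in> sets seq_algebra"
proof -
  have "{q \<in> space seq_algebra. q \<circ> Suc \<in> A \<and> q 0 = x \<and> q \<in> v} \<in> sets seq_algebra"
    by measurable
  then show ?thesis by (simp add: glue_def)
qed

lemma past_1_glue: "past 1 \<omega> \<in> glue A x v \<longleftrightarrow> past 0 \<omega> \<in> A \<and> \<omega> 0 = x \<and> past 1 \<omega> \<in> v"
proof -
  have "case_nat (\<omega> 0) (past 0 \<omega>) \<circ> Suc = past 0 \<omega>"
    by (simp add: fun_eq_iff)
  then show ?thesis by (simp add: past_1 glue_def)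
qed

lemma prob_step_future:
  assumes "s \<in> causal_states" and A [measurable]: "A \<in> sets seq_algebra" and "A \<subseteq> s"
    and B [measurable]: "B \<in> sets seq_algebra"
  shows "\<P>(\<omega> in P. past 0 \<omega> \<in> A \<and> \<omega> 0 = x \<and> future 1 \<omega> \<in> B) =
    \<P>(\<omega> in P. past 0 \<omega> \<in> A) * measure (state_law s) (glue B x UNIV)"
proof -
  have "glue B x UNIV \<in> sets seq_algebra"
    by (rule sets_glue[OF B UNIV_seq_algebra])
  from prob_past_future[OF assms(1-3) this] show ?thesis
    by (simp add: glue_def future_1) (simp add: future_def conj_commute)
qed

text \<open>The state at time 1 is a function of the past at time 0 and the symbol \<open>x\<close>.
  The joint probability with the future after time 1 can therefore be computed twice, by conditional
  independence at time 1 and at time 0.\<close>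

lemma prob_step_state_future:
  assumes s: "s \<in> causal_states" and v: "v \<in> causal_states"
    and A [measurable]: "A \<in> sets seq_algebra" and "A \<subseteq> s"
    and B [measurable]: "B \<in> sets seq_algebra"
  shows "\<P>(\<omega> in P. past 0 \<omega> \<in> A \<and> \<omega> 0 = x \<and> past 1 \<omega> \<in> v) * measure (state_law v) B =
    \<P>(\<omega> in P. past 0 \<omega> \<in> A \<and> case_nat x (past 0 \<omega>) \<in> v) * measure (state_law s) (glue B x UNIV)"
proof -
  note [measurable] = s v
  \<comment> \<open>Once the symbol is fixed to be \<open>x\<close>, reaching \<open>v\<close> is an
    event about the past at time 0 alone.\<close>
  define A' where "A' = {p. p \<in> A \<and> case_nat x p \<in> v}"
  have "{p \<in> space seq_algebra. p \<in> A \<and> case_nat x p \<in> v} \<in> sets seq_algebra"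
    by measurable
  then have A' [measurable]: "A' \<in> sets seq_algebra"
    by (simp add: A'_def)
  have "\<P>(\<omega> in P. past 0 \<omega> \<in> A \<and> \<omega> 0 = x \<and> past 1 \<omega> \<in> v) * measure (state_law v) B =
      \<P>(\<omega> in P. past 1 \<omega> \<in> glue A x v \<and> future 1 \<omega> \<in> B)"
    using prob_past_future_at[OF v sets_glue[OF A state_measurable[OF v]] _ B, of x 1]
    by (simp add: past_1_glue[symmetric]) (simp add: glue_def subset_iff)
  also have "\<dots> = \<P>(\<omega> in P. past 0 \<omega> \<in> A' \<and> \<omega> 0 = x \<and> future 1 \<omega> \<in> B)"
    unfolding past_1_glue by (rule arg_cong[where f = prob]) (auto simp: A'_def past_1)
  also have "\<dots> = \<P>(\<omega> in P. past 0 \<omega> \<in> A') * measure (state_law s) (glue B x UNIV)"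
    using \<open>A \<subseteq> s\<close> by (intro prob_step_future s A' B) (auto simp: A'_def)
  finally show ?thesis by (simp add: A'_def)
qed

section \<open>Unifilar transitions\<close>

text \<open>Positive probability is required because a null event may still lead from
  \<open>s\<close> on \<open>x\<close> to another state.\<close>

definition step :: "(nat \<Rightarrow> 'a) set \<Rightarrow> 'a \<Rightarrow> (nat \<Rightarrow> 'a) set \<Rightarrow> bool" where
  "step s x v \<longleftrightarrow> \<P>(\<omega> in P. past 0 \<omega> \<in> s \<and> \<omega> 0 = x \<and> past 1 \<omega> \<in> v) > 0"

definition emit :: "(nat \<Rightarrow> 'a) set \<Rightarrow> 'a \<Rightarrow> real" where
  "emit s x = measure (state_law s) {f. f 0 = x}"

lemma glue_UNIV: "glue UNIV x UNIV = {f. f 0 = x}"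
  by (simp add: glue_def)

text \<open>Taking \<open>B = UNIV\<close> in the double computation gives
  \<open>p = a * emit s x\<close>, where \<open>p\<close> is positive by \<open>step\<close>.
  Cancelling \<open>a\<close> from the identity for general \<open>B\<close> leaves the claim: the
  law of \<open>v\<close> is that of \<open>s\<close> conditioned on emitting
  \<open>x\<close>.\<close>

lemma step_law:
  assumes s: "s \<in> causal_states" and v: "v \<in> causal_states" and "step s x v"
    and B: "B \<in> sets seq_algebra"
  shows "measure (state_law s) (glue B x UNIV) = emit s x * measure (state_law v) B"
    and "emit s x > 0"
proof -
  interpret v: prob_space "state_law v" by (rule prob_space_state_law[OF v])
  define p where "p = \<P>(\<omega> in P. past 0 \<omega> \<in> s \<and> \<omega> 0 = x \<and> past 1 \<omega> \<in> v)"
  define a where "a = \<P>(\<omega> in P. past 0 \<omega> \<in> s \<and> case_nat x (past 0 \<omega>) \<in> v)"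
  have "measure (state_law v) UNIV = 1"
    using v.prob_space by simp
  then have p: "p = a * emit s x"
    using prob_step_state_future[OF s v state_measurable[OF s] subset_refl UNIV_seq_algebra, of x]
    by (simp add: emit_def glue_UNIV p_def a_def)
  have "p * measure (state_law v) B = a * measure (state_law s) (glue B x UNIV)"
    using prob_step_state_future[OF s v state_measurable[OF s] subset_refl B, of x]
    by (simp add: p_def a_def)
  moreover have "p > 0" using \<open>step s x v\<close> by (simp add: step_def p_def)
  then have "a \<noteq> 0" "emit s x \<noteq> 0" using p by auto
  ultimately show "measure (state_law s) (glue B x UNIV) = emit s x * measure (state_law v) B"
    by (simp add: p)
  show "emit s x > 0"
    using \<open>emit s x \<noteq> 0\<close> by (simp add: emit_def zero_less_measure_iff)
qed

text \<open>Unifilarity: the future laws of both successors are that of \<open>s\<close> conditioned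
  on the same symbol, and states with equal laws coincide.\<close>

lemma step_unique:
  assumes s: "s \<in> causal_states" and v: "v \<in> causal_states" and v': "v' \<in> causal_states"
    and "step s x v" "step s x v'"
  shows "v = v'"
proof (rule state_eqI[OF v v'])
  have "measure (state_law v) (cyl As) = measure (state_law v') (cyl As)" for As
    using step_law(1)[OF s v \<open>step s x v\<close> sets_cyl[of As]] step_law[OF s v' \<open>step s x v'\<close> sets_cyl[of As]]
    by simp
  then show "state_law v = state_law v'"
    by (intro measure_eqI_cyl prob_space_state_law v v') simp_all
qed

lemma prob_not_step:
  assumes s: "s \<in> causal_states" and v: "v \<in> causal_states" and "A \<subseteq> s" and "\<not> step s x v"
  shows "\<P>(\<omega> in P. past 0 \<omega> \<in> A \<and> \<omega> 0 = x \<and> past 1 \<omega> \<in> v) = 0"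
proof -
  note [measurable] = s v
  have "\<P>(\<omega> in P. past 0 \<omega> \<in> A \<and> \<omega> 0 = x \<and> past 1 \<omega> \<in> v) \<le>
      \<P>(\<omega> in P. past 0 \<omega> \<in> s \<and> \<omega> 0 = x \<and> past 1 \<omega> \<in> v)"
    using \<open>A \<subseteq> s\<close> by (intro prob_Collect_mono) auto
  with \<open>\<not> step s x v\<close> show ?thesis
    by (simp add: step_def) (meson measure_nonneg order_antisym order_trans not_le_imp_less)
qed

lemma prob_emit:
  assumes "s \<in> causal_states" and "A \<in> sets seq_algebra" and "A \<subseteq> s"
  shows "\<P>(\<omega> in P. past 0 \<omega> \<in> A \<and> \<omega> 0 = x) = \<P>(\<omega> in P. past 0 \<omega> \<in> A) * emit s x"
  using prob_step_future[OF assms UNIV_seq_algebra, of x]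
  by (simp add: emit_def glue_UNIV)

lemma prob_emit_sum:
  assumes s: "s \<in> causal_states" and [measurable]: "A \<in> sets seq_algebra" and "A \<subseteq> s"
  shows "\<P>(\<omega> in P. past 0 \<omega> \<in> A) * emit s x =
    (\<Sum>v\<in>causal_states. \<P>(\<omega> in P. past 0 \<omega> \<in> A \<and> \<omega> 0 = x \<and> past 1 \<omega> \<in> v))"
  using prob_states_sum[of "\<lambda>\<omega>. past 0 \<omega> \<in> A \<and> \<omega> 0 = x" 1] prob_emit[OF assms, of x]
  by simp

text \<open>By unifilarity only the term of \<open>v\<close> survives in the sum over
  successors.\<close>

lemma prob_step:
  assumes s: "s \<in> causal_states" and v: "v \<in> causal_states"
    and A: "A \<in> sets seq_algebra" "A \<subseteq> s" and st: "step s x v"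
  shows "\<P>(\<omega> in P. past 0 \<omega> \<in> A \<and> \<omega> 0 = x \<and> past 1 \<omega> \<in> v) = \<P>(\<omega> in P. past 0 \<omega> \<in> A) * emit s x"
proof -
  have "(\<Sum>u\<in>causal_states - {v}. \<P>(\<omega> in P. past 0 \<omega> \<in> A \<and> \<omega> 0 = x \<and> past 1 \<omega> \<in> u)) = 0"
    using step_unique[OF s v _ st] prob_not_step[OF s _ A(2)] by (intro sum.neutral) blast
  then show ?thesis
    unfolding prob_emit_sum[OF s A] using v by (simp add: sum.remove)
qed

text \<open>Otherwise every successor would contribute zero to the positive probability of emitting
  \<open>x\<close> from \<open>s\<close>.\<close>

lemma step_exists:
  assumes s: "s \<in> causal_states" and "emit s x > 0"
  shows "\<exists>v\<in>causal_states. step s x v"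
proof (rule ccontr)
  assume "\<not> ?thesis"
  then have "(\<Sum>v\<in>causal_states. \<P>(\<omega> in P. past 0 \<omega> \<in> s \<and> \<omega> 0 = x \<and> past 1 \<omega> \<in> v)) = 0"
    using prob_not_step[OF s _ subset_refl] by (intro sum.neutral) blast
  with prob_emit_sum[OF s state_measurable[OF s] subset_refl, of x] prob_state_pos[OF s] assms(2)
  show False by simp
qed

lemma trans_eps_machine:
  assumes s: "s \<in> causal_states" and v: "v \<in> causal_states"
  shows "trans (eps_machine P K) s x v = (if step s x v then emit s x else 0)"
proof -
  have "trans (eps_machine P K) s x v =
      \<P>(\<omega> in P. past 0 \<omega> \<in> s \<and> \<omega> 0 = x \<and> past 1 \<omega> \<in> v) / \<P>(\<omega> in P. past 0 \<omega> \<in> s)"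
    by (simp add: eps_machine_def cond_prob_def causal_state_iff[OF s] causal_state_iff[OF v] conj_ac)
  then show ?thesis
    using prob_state_pos[OF s] prob_step[OF s v state_measurable[OF s] subset_refl, of x]
      prob_not_step[OF s v subset_refl, of x]
    by auto
qed

lemma prob_trans:
  assumes "s \<in> causal_states" "v \<in> causal_states" "A \<in> sets seq_algebra" "A \<subseteq> s"
  shows "\<P>(\<omega> in P. past 0 \<omega> \<in> A \<and> \<omega> 0 = x \<and> past 1 \<omega> \<in> v) =
    \<P>(\<omega> in P. past 0 \<omega> \<in> A) * trans (eps_machine P K) s x v"
  using prob_step[OF assms, of x] prob_not_step[OF assms(1,2,4), of x] trans_eps_machine[OF assms(1,2)]
  by simp

section \<open>Word probabilities of the machine\<close>

text \<open>The starting event is an arbitrary measurable part of \<open>u\<close> so that the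
  induction closes: after one symbol it becomes \<open>glue A x v\<close>, in general only a part of
  \<open>v\<close>, and stationarity brings it back to time 0.\<close>

lemma prob_word_trans:
  assumes u: "u \<in> causal_states" and s': "s' \<in> causal_states" and "A \<in> sets seq_algebra" and "A \<subseteq> u"
  shows "\<P>(\<omega> in P. past 0 \<omega> \<in> A \<and> block 0 (int (length w)) \<omega> = w \<and> past (int (length w)) \<omega> \<in> s') =
    \<P>(\<omega> in P. past 0 \<omega> \<in> A) * word_trans (eps_machine P K) u w s'"
  using assms
proof (induction w arbitrary: u A)
  case Nil
  have "past 0 \<omega> \<in> A \<and> past 0 \<omega> \<in> s' \<longleftrightarrow> u = s' \<and> past 0 \<omega> \<in> A" for \<omega>
    using states_disjoint[OF Nil(1,2)] Nil(4) by blast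
  then show ?case by (simp add: block_def)
next
  case (Cons x w)
  let ?n = "int (length w)"
  note u = Cons.prems(1)
  note [measurable] = s' Cons.prems(3)
  have "\<P>(\<omega> in P. past 0 \<omega> \<in> A \<and> block 0 (int (length (x # w))) \<omega> = x # w \<and>
        past (int (length (x # w))) \<omega> \<in> s') =
      (\<Sum>v\<in>causal_states. \<P>(\<omega> in P. (past 0 \<omega> \<in> A \<and> block 0 (int (length (x # w))) \<omega> = x # w \<and>
        past (int (length (x # w))) \<omega> \<in> s') \<and> past (int 1) \<omega> \<in> v))"
    by (rule prob_states_sum) measurable
  also have "\<dots> = (\<Sum>v\<in>causal_states. \<P>(\<omega> in P. past 0 \<omega> \<in> A) *
      (trans (eps_machine P K) u x v * word_trans (eps_machine P K) v w s'))"
  proof (rule sum.cong[OF refl])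
    fix v assume v: "v \<in> causal_states"
    note [measurable] = v
    have "\<P>(\<omega> in P. (past 0 \<omega> \<in> A \<and> block 0 (int (length (x # w))) \<omega> = x # w \<and>
        past (int (length (x # w))) \<omega> \<in> s') \<and> past (int 1) \<omega> \<in> v) =
      \<P>(\<omega> in P. past 0 (time_shift 1 \<omega>) \<in> glue A x v \<and> block 0 ?n (time_shift 1 \<omega>) = w \<and>
        past ?n (time_shift 1 \<omega>) \<in> s')"
      by (rule arg_cong[where f = prob])
        (auto simp: block_Cons[simplified] past_shift[where n = 1, simplified] past_1_glue add.commute)
    also have "\<dots> = \<P>(\<omega> in P. past 0 \<omega> \<in> glue A x v \<and> block 0 ?n \<omega> = w \<and> past ?n \<omega> \<in> s')"
      by (rule prob_shift) measurable
    also have "\<dots> = \<P>(\<omega> in P. past 0 \<omega> \<in> glue A x v) * word_trans (eps_machine P K) v w s'"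
      by (rule Cons.IH[OF v s']) (measurable, auto simp: glue_def)
    also have "\<P>(\<omega> in P. past 0 \<omega> \<in> glue A x v) = \<P>(\<omega> in P. past 1 \<omega> \<in> glue A x v)"
      using prob_shift[of "\<lambda>\<omega>. past 0 \<omega> \<in> glue A x v" 1] by (simp add: past_shift[where n = 1, simplified])
    also have "\<dots> = \<P>(\<omega> in P. past 0 \<omega> \<in> A) * trans (eps_machine P K) u x v"
      unfolding past_1_glue by (rule prob_trans[OF u v Cons.prems(3,4)])
    finally show "\<P>(\<omega> in P. (past 0 \<omega> \<in> A \<and> block 0 (int (length (x # w))) \<omega> = x # w \<and>
        past (int (length (x # w))) \<omega> \<in> s') \<and> past (int 1) \<omega> \<in> v) =
      \<P>(\<omega> in P. past 0 \<omega> \<in> A) * (trans (eps_machine P K) u x v * word_trans (eps_machine P K) v w s')"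
      by (simp only: mult.assoc)
  qed
  finally show ?case
    by (simp add: sum_distrib_left causal_states_def)
qed

text \<open>The word ends at time 0, as in the Markov condition, instead of starting there as in the
  synchronization order.\<close>

definition joint :: "'a list \<Rightarrow> (nat \<Rightarrow> 'a) set \<Rightarrow> real" where
  "joint w s = \<P>(\<omega> in P. block (- int (length w)) 0 \<omega> = w \<and> past 0 \<omega> \<in> s)"

lemma joint_nonneg: "0 \<le> joint w s"
  by (simp add: joint_def)

text \<open>Stationarity moves the window to start at time 0; splitting by the initial state then
  produces the path weights.\<close>

lemma word_law:
  assumes s': "s' \<in> causal_states"
  shows "(\<Sum>s\<in>causal_states. init (eps_machine P K) s * word_trans (eps_machine P K) s w s') = joint w s'"
proof -
  let ?n = "int (length w)"
  note [measurable] = s'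
  have "joint w s' = \<P>(\<omega> in P. block 0 ?n \<omega> = w \<and> past ?n \<omega> \<in> s')"
    using prob_shift[of "\<lambda>\<omega>. block (- ?n) 0 \<omega> = w \<and> past 0 \<omega> \<in> s'" "length w"]
    by (simp add: joint_def block_shift past_shift)
  also have "\<dots> = (\<Sum>s\<in>causal_states. \<P>(\<omega> in P. (block 0 ?n \<omega> = w \<and> past ?n \<omega> \<in> s') \<and> past (int 0) \<omega> \<in> s))"
    by (rule prob_states_sum) measurable
  also have "\<dots> = (\<Sum>s\<in>causal_states. init (eps_machine P K) s * word_trans (eps_machine P K) s w s')"
  proof (rule sum.cong[OF refl])
    fix s assume s: "s \<in> causal_states"
    show "\<P>(\<omega> in P. (block 0 ?n \<omega> = w \<and> past ?n \<omega> \<in> s') \<and> past (int 0) \<omega> \<in> s) =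
        init (eps_machine P K) s * word_trans (eps_machine P K) s w s'"
      using prob_word_trans[OF s s' state_measurable[OF s] subset_refl, of w]
      by (simp add: eps_machine_def[of P K, THEN arg_cong[of _ _ init]] causal_state_iff[OF s] conj_ac)
  qed
  finally show ?thesis ..
qed

lemma joint_sum: "(\<Sum>z\<in>{w. length w = l} \<times> causal_states. joint (fst z) (snd z)) = 1"
proof -
  have fin: "finite {w :: 'a list. length w = l}"
    using finite_lists_length_eq[of "UNIV :: 'a set"] by simp
  have "(\<Sum>z\<in>{w. length w = l} \<times> causal_states. joint (fst z) (snd z)) =
      (\<Sum>w | length w = l. \<Sum>s\<in>causal_states. joint w s)"
    by (simp add: sum.cartesian_product split_beta')
  also have "\<dots> = (\<Sum>w | length w = l. \<P>(\<omega> in P. block (- int l) 0 \<omega> = w))"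
  proof (rule sum.cong[OF refl])
    fix w :: "'a list" assume "w \<in> {w. length w = l}"
    then show "(\<Sum>s\<in>causal_states. joint w s) = \<P>(\<omega> in P. block (- int l) 0 \<omega> = w)"
      using prob_states_sum[of "\<lambda>\<omega>. block (- int l) 0 \<omega> = w" 0] by (simp add: joint_def)
  qed
  also have "\<dots> = \<P>(\<omega> in P. True)"
    by (rule prob_sum[OF fin, symmetric]) (measurable, auto)
  finally show ?thesis using prob_space by simp
qed

lemma state_uncertainty_eq_0_iff:
  "state_uncertainty (eps_machine P K) l = 0 \<longleftrightarrow>
    (\<forall>w. length w = l \<longrightarrow> (\<forall>s\<in>causal_states. \<forall>s'\<in>causal_states. 0 < joint w s \<longrightarrow> 0 < joint w s' \<longrightarrow> s = s'))"
proof -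
  let ?L = "{w :: 'a list. length w = l}"
  have fin: "finite ?L"
    using finite_lists_length_eq[of "UNIV :: 'a set"] by simp
  have ne: "?L \<noteq> {}"
    by (auto intro: exI[of _ "replicate l undefined"])
  \<comment> \<open>An empty set of states would make the total mass 0 instead of 1.\<close>
  have "causal_states \<noteq> {}"
    using joint_sum[of l] by auto
  have "word_state_law (eps_machine P K) l =
      point_measure (?L \<times> causal_states) (\<lambda>z. ennreal (joint (fst z) (snd z)))"
    unfolding word_state_law_def causal_states_def[symmetric] point_measure_def
    by (rule density_cong) (auto simp: AE_count_space word_law)
  then have "state_uncertainty (eps_machine P K) l = prob_space.conditional_entropy
      (point_measure (?L \<times> causal_states) (\<lambda>z. ennreal (joint (fst z) (snd z)))) 2
      (count_space causal_states) (count_space ?L) snd fst"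
    by (simp add: state_uncertainty_def causal_states_def)
  then show ?thesis
    using conditional_entropy_eq_0_iff[OF fin ne finite_causal_states \<open>causal_states \<noteq> {}\<close>,
        of "\<lambda>z. joint (fst z) (snd z)"] joint_sum[of l] joint_nonneg
    by simp
qed

section \<open>The Markov property in terms of the kernel\<close>

abbreviation past_algebra :: "(int \<Rightarrow> 'a) measure" where
  "past_algebra \<equiv> vimage_algebra (space P) (past 0) seq_algebra"

abbreviation block_algebra :: "nat \<Rightarrow> (int \<Rightarrow> 'a) measure" where
  "block_algebra l \<equiv> vimage_algebra (space P) (block (- int l) 0) (count_space UNIV)"

lemma sigma_finite_subalgebra_vimage:
  assumes "f \<in> P \<rightarrow>\<^sub>M N"
  shows "sigma_finite_subalgebra P (vimage_algebra (space P) f N)"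
proof (rule finite_measure_subalgebra_is_sigma_finite, unfold_locales)
  show "subalgebra P (vimage_algebra (space P) f N)"
    using sets_image_in_sets[OF refl assms] by (simp add: subalgebra_def)
qed

text \<open>An explicit version of the conditional probability of \<open>x\<close> at time 0 given
  the whole past.\<close>

definition next_prob :: "'a \<Rightarrow> (int \<Rightarrow> 'a) \<Rightarrow> real" where
  "next_prob x \<omega> = measure (K (past 0 \<omega>)) {f. f 0 = x}"

lemma sets_first [measurable]: "{f. f 0 = x} \<in> sets (seq_algebra :: (nat \<Rightarrow> 'a) measure)"
proof -
  have "{f \<in> space seq_algebra. f 0 = x} \<in> sets (seq_algebra :: (nat \<Rightarrow> 'a) measure)"
    by measurable
  then show ?thesis by simp
qed

lemma measurable_kernel_first [measurable]:
  "(\<lambda>p. measure (K p) {f. f 0 = x}) \<in> borel_measurable seq_algebra"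
  by measurable

lemma next_prob_measurable [measurable]: "next_prob x \<in> borel_measurable P"
  unfolding next_prob_def by measurable

lemma next_prob_state: "s \<in> causal_states \<Longrightarrow> past 0 \<omega> \<in> s \<Longrightarrow> next_prob x \<omega> = emit s x"
  by (simp add: next_prob_def emit_def kernel_state)

lemma integrable_next_prob [simp]: "integrable P (next_prob x)"
  by (rule integrable_const_bound[of _ 1])
    (auto simp: next_prob_def prob_space.prob_le_1[OF prob_space_kernel])

lemma first_event [measurable]: "{\<omega>. \<omega> 0 = x} \<in> events"
proof -
  have "{\<omega> \<in> space P. \<omega> 0 = x} \<in> events" by measurable
  then show ?thesis by simp
qed

text \<open>This is the defining equation of the kernel for the future event that the first symbol
  is \<open>x\<close>, rewritten with real integrals.\<close>

lemma set_integral_next_prob: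
  assumes A: "A \<in> sets past_algebra"
  shows "(\<integral>\<omega>\<in>A. indicator {\<omega>. \<omega> 0 = x} \<omega> \<partial>P) = (\<integral>\<omega>\<in>A. next_prob x \<omega> \<partial>P)"
proof -
  obtain B where B [measurable]: "B \<in> sets seq_algebra" and A_eq: "A = {\<omega> \<in> space P. past 0 \<omega> \<in> B}"
    using A by (auto simp: sets_vimage_algebra2)
  have [measurable]: "A \<in> events" unfolding A_eq by measurable
  have "(\<integral>\<omega>\<in>A. next_prob x \<omega> \<partial>P) =
      enn2real (\<integral>\<^sup>+\<omega>. ennreal (indicator A \<omega> * next_prob x \<omega>) \<partial>P)"
    unfolding set_lebesgue_integral_def real_scaleR_def
    by (rule integral_eq_nn_integral) (measurable, simp add: next_prob_def)
  also have "(\<integral>\<^sup>+\<omega>. ennreal (indicator A \<omega> * next_prob x \<omega>) \<partial>P) =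
      (\<integral>\<^sup>+\<omega>. emeasure (K (past 0 \<omega>)) {f. f 0 = x} * indicator B (past 0 \<omega>) \<partial>P)"
    by (intro nn_integral_cong)
      (auto simp: A_eq next_prob_def indicator_def prob_space_kernel
        finite_measure.emeasure_eq_measure prob_space.finite_measure)
  also have "\<dots> = emeasure P {\<omega> \<in> space P. past 0 \<omega> \<in> B \<and> future 0 \<omega> \<in> {f. f 0 = x}}"
    using kernel[unfolded future_kernel_def, THEN conjunct2, rule_format, OF B sets_first[of x]] by (rule sym)
  also have "{\<omega> \<in> space P. past 0 \<omega> \<in> B \<and> future 0 \<omega> \<in> {f. f 0 = x}} = A \<inter> {\<omega>. \<omega> 0 = x}"
    by (auto simp: A_eq future_def)
  also have "enn2real (emeasure P (A \<inter> {\<omega>. \<omega> 0 = x})) = (\<integral>\<omega>\<in>A. indicator {\<omega>. \<omega> 0 = x} \<omega> \<partial>P)"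
    by (simp add: set_lebesgue_integral_def indicator_inter_arith[symmetric] measure_def)
  finally show ?thesis ..
qed

lemma real_cond_exp_past:
  "AE \<omega> in P. \<forall>x. real_cond_exp P past_algebra (indicator {\<omega>. \<omega> 0 = x}) \<omega> = next_prob x \<omega>"
  unfolding AE_all_countable
proof
  fix x
  interpret sigma_finite_subalgebra P past_algebra
    by (rule sigma_finite_subalgebra_vimage) measurable
  show "AE \<omega> in P. real_cond_exp P past_algebra (indicator {\<omega>. \<omega> 0 = x}) \<omega> = next_prob x \<omega>"
  proof (rule real_cond_exp_charact)
    show "next_prob x \<in> borel_measurable past_algebra"
      unfolding next_prob_def
      by (rule measurable_compose[OF measurable_vimage_algebra1 measurable_kernel_first]) simp
    show "integrable P (indicator {\<omega>. \<omega> 0 = x} :: _ \<Rightarrow> real)"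
      by (simp add: emeasure_eq_measure)
  qed (fact integrable_next_prob set_integral_next_prob)+
qed

lemma block_algebra_subset: "sets (block_algebra l) \<subseteq> sets past_algebra"
proof
  fix A assume "A \<in> sets (block_algebra l)"
  then obtain C where A: "A = block (- int l) 0 -` C"
    by (auto simp: sets_vimage_algebra2)
  have "(\<lambda>p. map p (rev [0..<l])) \<in> seq_algebra \<rightarrow>\<^sub>M (count_space UNIV :: 'a list measure)"
    by (rule measurable_map_list[where f = "\<lambda>i p. p i"]) measurable
  then have "(\<lambda>p. map p (rev [0..<l])) -` C \<in> sets seq_algebra"
    using measurable_sets[of "\<lambda>p. map p (rev [0..<l])" seq_algebra "count_space UNIV" C] by simp
  moreover have "A = past 0 -` ((\<lambda>p. map p (rev [0..<l])) -` C)"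
    by (auto simp: A block_past)
  ultimately show "A \<in> sets past_algebra"
    by (auto simp: sets_vimage_algebra2)
qed

text \<open>A conditional expectation given the block is a function of the block, which gives one
  direction. Conversely, if \<open>next_prob\<close> is almost surely such a function, it has the
  right integrals over block events and so is also the conditional probability given the
  block.\<close>

lemma markov_at_iff:
  "markov_at P l \<longleftrightarrow> (\<exists>h. AE \<omega> in P. \<forall>x. next_prob x \<omega> = h (block (- int l) 0 \<omega>) x)"
proof
  assume "markov_at P l"
  have "\<forall>x. \<exists>h. \<forall>\<omega>. real_cond_exp P (block_algebra l) (indicator {\<omega>. \<omega> 0 = x}) \<omega> =
      h (block (- int l) 0 \<omega>)"
    using borel_measurable_cond_exp[of P "block_algebra l"]
    by (intro allI vimage_algebra_count_space_factor) (simp only: space_P)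
  then obtain h where h: "\<And>x \<omega>. real_cond_exp P (block_algebra l) (indicator {\<omega>. \<omega> 0 = x}) \<omega> =
      h x (block (- int l) 0 \<omega>)"
    unfolding choice_iff by blast
  have "AE \<omega> in P. \<forall>x. next_prob x \<omega> = h x (block (- int l) 0 \<omega>)"
    using \<open>markov_at P l\<close> real_cond_exp_past unfolding markov_at_def h
    by eventually_elim metis
  then show "\<exists>h. AE \<omega> in P. \<forall>x. next_prob x \<omega> = h (block (- int l) 0 \<omega>) x"
    by (intro exI[of _ "\<lambda>w x. h x w"])
next
  assume "\<exists>h. AE \<omega> in P. \<forall>x. next_prob x \<omega> = h (block (- int l) 0 \<omega>) x"
  then obtain h where h: "AE \<omega> in P. \<forall>x. next_prob x \<omega> = h (block (- int l) 0 \<omega>) x" ..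
  interpret sigma_finite_subalgebra P "block_algebra l"
    by (rule sigma_finite_subalgebra_vimage) measurable
  have "AE \<omega> in P. real_cond_exp P (block_algebra l) (indicator {\<omega>. \<omega> 0 = x}) \<omega> = h (block (- int l) 0 \<omega>) x" for x
  proof (rule real_cond_exp_charact)
    have hx: "AE \<omega> in P. next_prob x \<omega> = h (block (- int l) 0 \<omega>) x"
      using h by eventually_elim simp
    have hm [measurable]: "(\<lambda>\<omega>. h (block (- int l) 0 \<omega>) x) \<in> borel_measurable P"
      by (rule measurable_compose[OF measurable_block, of "\<lambda>w. h w x"]) simp
    have "block (- int l) 0 \<in> block_algebra l \<rightarrow>\<^sub>M count_space UNIV"
      by (rule measurable_vimage_algebra1) simp
    from measurable_compose[OF this, of "\<lambda>w. h w x"]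
    show "(\<lambda>\<omega>. h (block (- int l) 0 \<omega>) x) \<in> borel_measurable (block_algebra l)"
      by simp
    show "integrable P (indicator {\<omega>. \<omega> 0 = x} :: _ \<Rightarrow> real)"
      by (simp add: emeasure_eq_measure)
    show "integrable P (\<lambda>\<omega>. h (block (- int l) 0 \<omega>) x)"
      by (rule integrable_cong_AE_imp[OF integrable_next_prob[of x] hm])
        (use hx in eventually_elim, simp)
    fix A assume A: "A \<in> sets (block_algebra l)"
    then have [measurable]: "A \<in> events"
      using subalg by (auto simp: subalgebra_def)
    \<comment> \<open>Every block event is an event of the past, where the integrals are
      known.\<close>
    have "(\<integral>\<omega>\<in>A. indicator {\<omega>. \<omega> 0 = x} \<omega> \<partial>P) = (\<integral>\<omega>\<in>A. next_prob x \<omega> \<partial>P)"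
      using A block_algebra_subset by (intro set_integral_next_prob) blast
    also have "\<dots> = (\<integral>\<omega>\<in>A. h (block (- int l) 0 \<omega>) x \<partial>P)"
      unfolding set_lebesgue_integral_def
    proof (rule integral_cong_AE)
      show "AE \<omega> in P. indicat_real A \<omega> *\<^sub>R next_prob x \<omega> = indicat_real A \<omega> *\<^sub>R h (block (- int l) 0 \<omega>) x"
        using hx by eventually_elim simp
    qed measurable
    finally show "(\<integral>\<omega>\<in>A. indicator {\<omega>. \<omega> 0 = x} \<omega> \<partial>P) = (\<integral>\<omega>\<in>A. h (block (- int l) 0 \<omega>) x \<partial>P)" .
  qed
  then have "AE \<omega> in P. \<forall>x. real_cond_exp P (block_algebra l) (indicator {\<omega>. \<omega> 0 = x}) \<omega> = h (block (- int l) 0 \<omega>) x"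
    by (simp add: AE_all_countable)
  then show "markov_at P l"
    using h real_cond_exp_past unfolding markov_at_def by eventually_elim metis
qed

section \<open>Markov order and synchronization\<close>

text \<open>Following the step multiplies the weight by \<open>emit s x\<close>, which is positive;
  the window then moves on by one symbol.\<close>

lemma joint_pos_slide:
  assumes s: "s \<in> causal_states" and v: "v \<in> causal_states" and "step s x v" and "0 < joint w s"
  shows "0 < joint (tl (w @ [x])) v"
proof -
  let ?l = "length w"
  note [measurable] = s v
  \<comment> \<open>The word is encoded as an event of the past inside \<open>s\<close>, to which
    \<open>prob_step\<close> applies.\<close>
  define A where "A = s \<inter> {p. map p (rev [0..<?l]) = w}"
  have "(\<lambda>p. map p (rev [0..<?l])) \<in> seq_algebra \<rightarrow>\<^sub>M (count_space UNIV :: 'a list measure)"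
    by (rule measurable_map_list[where f = "\<lambda>i p. p i"]) measurable
  then have "{p \<in> space seq_algebra. p \<in> s \<and> map p (rev [0..<?l]) = w} \<in> sets seq_algebra"
    by measurable
  then have A: "A \<in> sets seq_algebra" "A \<subseteq> s"
    by (auto simp: A_def Int_def)
  have past_A: "past 0 \<omega> \<in> A \<longleftrightarrow> block (- int ?l) 0 \<omega> = w \<and> past 0 \<omega> \<in> s" for \<omega>
    by (auto simp: A_def block_past)
  have "0 < joint w s * emit s x"
    using assms(4) step_law(2)[OF s v \<open>step s x v\<close> UNIV_seq_algebra] by simp
  also have "\<dots> = \<P>(\<omega> in P. past 0 \<omega> \<in> A \<and> \<omega> 0 = x \<and> past 1 \<omega> \<in> v)"
    using prob_step[OF s v A \<open>step s x v\<close>] by (simp add: joint_def past_A)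
  also have "\<dots> \<le> \<P>(\<omega> in P. block (1 - int ?l) 1 \<omega> = tl (w @ [x]) \<and> past 1 \<omega> \<in> v)"
    by (rule prob_Collect_mono, measurable) (simp add: past_A block_slide)
  also have "\<dots> = \<P>(\<omega> in P. block (- int ?l) 0 \<omega> = tl (w @ [x]) \<and> past 0 \<omega> \<in> v)"
    using prob_shift[of "\<lambda>\<omega>. block (- int ?l) 0 \<omega> = tl (w @ [x]) \<and> past 0 \<omega> \<in> v" 1]
    by (simp add: block_shift[where n = 1, simplified] past_shift[where n = 1, simplified] algebra_simps)
  also have "\<dots> = joint (tl (w @ [x])) v"
    by (simp add: joint_def)
  finally show ?thesis .
qed

lemma measure_cyl_Cons:
  assumes "s \<in> causal_states"
  shows "measure (state_law s) (cyl (A # As)) = (\<Sum>x\<in>A. measure (state_law s) (glue (cyl As) x UNIV))"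
proof -
  interpret s: prob_space "state_law s" by (rule prob_space_state_law[OF assms])
  have "cyl (A # As) = (\<Union>x\<in>A. glue (cyl As) x UNIV)"
    by (auto simp: glue_def)
  moreover have "disjoint_family_on (\<lambda>x. glue (cyl As) x UNIV) A"
    by (auto simp: disjoint_family_on_def glue_def)
  ultimately show ?thesis
    by (simp add: s.finite_measure_finite_Union image_subset_iff sets_glue)
qed

text \<open>Two states sharing a word emit alike, and on each symbol of positive probability their
  successors again share a word of length \<open>l\<close>. Hence word and states must vary in the
  induction.\<close>

lemma measure_cyl_eq_of_markov:
  assumes emit: "\<And>w s x. length w = l \<Longrightarrow> s \<in> causal_states \<Longrightarrow> 0 < joint w s \<Longrightarrow> emit s x = h w x"
  shows "\<lbrakk>length w = l; s \<in> causal_states; s' \<in> causal_states; 0 < joint w s; 0 < joint w s'\<rbrakk> \<Longrightarrow>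
    measure (state_law s) (cyl As) = measure (state_law s') (cyl As)"
proof (induction As arbitrary: w s s')
  case Nil
  then show ?case
    using prob_space.prob_space[OF prob_space_state_law] by simp
next
  case (Cons A As)
  note s = Cons.prems(2) and s' = Cons.prems(3)
  have "measure (state_law s) (glue (cyl As) x UNIV) = measure (state_law s') (glue (cyl As) x UNIV)" for x
  proof -
    have e: "emit s x = emit s' x"
      using emit[OF Cons.prems(1) s Cons.prems(4)] emit[OF Cons.prems(1) s' Cons.prems(5)] by simp
    show ?thesis
    proof (cases "emit s x > 0")
      case True
      then obtain v v' where v: "v \<in> causal_states" "step s x v" and v': "v' \<in> causal_states" "step s' x v'"
        using step_exists[OF s, of x] step_exists[OF s', of x] e by auto
      \<comment> \<open>The new word depends on \<open>w\<close> and \<open>x\<close> only, so it is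
        common to both successors.\<close>
      have "measure (state_law v) (cyl As) = measure (state_law v') (cyl As)"
        using Cons.prems(1)
        by (intro Cons.IH[of "tl (w @ [x])"] v v' joint_pos_slide[OF s v Cons.prems(4)]
            joint_pos_slide[OF s' v' Cons.prems(5)]) simp
      then show ?thesis
        using step_law(1)[OF s v sets_cyl] step_law(1)[OF s' v' sets_cyl] e by simp
    next
      case False
      \<comment> \<open>A symbol of probability zero has no successor to follow, but then both sides
        vanish.\<close>
      have "measure (state_law u) (glue (cyl As) x UNIV) = 0" if "u \<in> causal_states" "emit u x = emit s x" for u
      proof -
        interpret u: prob_space "state_law u" by (rule prob_space_state_law[OF that(1)])
        have "measure (state_law u) (glue (cyl As) x UNIV) \<le> emit u x"
          unfolding emit_def by (rule u.finite_measure_mono) (auto simp: glue_def)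
        also have "\<dots> \<le> 0" using that False by simp
        finally show ?thesis by (simp add: measure_le_0_iff)
      qed
      then show ?thesis using s s' e by simp
    qed
  qed
  then show ?case
    unfolding measure_cyl_Cons[OF s] measure_cyl_Cons[OF s'] by simp
qed

text \<open>The exceptional set is a union of null events over countably many words and finitely
  many states.\<close>

lemma AE_joint_pos:
  "AE \<omega> in P. \<forall>s\<in>causal_states. past 0 \<omega> \<in> s \<longrightarrow> 0 < joint (block (- int l) 0 \<omega>) s"
proof -
  have "AE \<omega> in P. length w = l \<longrightarrow> joint w s = 0 \<longrightarrow> \<not> (block (- int l) 0 \<omega> = w \<and> past 0 \<omega> \<in> s)"
    if [measurable]: "s \<in> causal_states" for w s
  proof (cases "length w = l \<and> joint w s = 0")
    case True
    then show ?thesis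
      using prob_Collect_eq_0_iff[of "\<lambda>\<omega>. block (- int l) 0 \<omega> = w \<and> past 0 \<omega> \<in> s"]
      by (simp add: joint_def)
  qed auto
  then have "AE \<omega> in P. \<forall>s\<in>causal_states. \<forall>w. length w = l \<longrightarrow> joint w s = 0 \<longrightarrow>
      \<not> (block (- int l) 0 \<omega> = w \<and> past 0 \<omega> \<in> s)"
    by (intro AE_finite_allI finite_causal_states) (simp only: AE_all_countable, blast)
  then show ?thesis
    by eventually_elim (auto simp: less_le joint_nonneg)
qed

lemma markov_at_iff_sync:
  "markov_at P l \<longleftrightarrow> state_uncertainty (eps_machine P K) l = 0"
  unfolding markov_at_iff state_uncertainty_eq_0_iff
proof (intro iffI allI impI ballI; (elim exE)?)
  fix h w s s'
  assume h: "AE \<omega> in P. \<forall>x. next_prob x \<omega> = h (block (- int l) 0 \<omega>) x" and len: "length w = l"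
    and s: "s \<in> causal_states" and s': "s' \<in> causal_states" and pos: "0 < joint w s" "0 < joint w s'"
  \<comment> \<open>If the values differed, the event of seeing \<open>w'\<close> in state
    \<open>u\<close> would lie in the exceptional null set, against its positive
    probability.\<close>
  have emit: "emit u x = h w' x" if len': "length w' = l" and u: "u \<in> causal_states" and "0 < joint w' u" for w' u x
  proof (rule ccontr)
    assume neq: "emit u x \<noteq> h w' x"
    note [measurable] = u
    have "AE \<omega> in P. \<not> (block (- int l) 0 \<omega> = w' \<and> past 0 \<omega> \<in> u)"
      using h by eventually_elim (use neq next_prob_state[OF u] in auto)
    then have "joint w' u = 0"
      using prob_Collect_eq_0_iff[of "\<lambda>\<omega>. block (- int l) 0 \<omega> = w' \<and> past 0 \<omega> \<in> u"] len'
      by (simp add: joint_def)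
    then show False using that by simp
  qed
  have "state_law s = state_law s'"
    by (intro measure_eqI_cyl prob_space_state_law s s' measure_cyl_eq_of_markov[OF emit len s s' pos]) simp_all
  then show "s = s'" using s s' state_eqI by blast
next
  assume sync: "\<forall>w. length w = l \<longrightarrow>
    (\<forall>s\<in>causal_states. \<forall>s'\<in>causal_states. 0 < joint w s \<longrightarrow> 0 < joint w s' \<longrightarrow> s = s')"
  define h where "h w x = emit (SOME s. s \<in> causal_states \<and> 0 < joint w s) x" for w x
  have h: "emit s x = h w x" if "length w = l" "s \<in> causal_states" "0 < joint w s" for w s x
  proof -
    have "(SOME s. s \<in> causal_states \<and> 0 < joint w s) = s"
      using sync that by (intro some_equality) auto
    then show ?thesis by (simp add: h_def)
  qed
  have "AE \<omega> in P. \<forall>x. next_prob x \<omega> = h (block (- int l) 0 \<omega>) x"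
    using AE_past_state[of 0] AE_joint_pos[of l]
  proof eventually_elim
    case (elim \<omega>)
    then obtain s where "s \<in> causal_states" "past 0 \<omega> \<in> s" "0 < joint (block (- int l) 0 \<omega>) s"
      by auto
    then show ?case
      using h next_prob_state by simp
  qed
  then show "\<exists>h. AE \<omega> in P. \<forall>x. next_prob x \<omega> = h (block (- int l) 0 \<omega>) x" by (intro exI[of _ h])
qed

end

theorem proposition2:
  fixes P :: "(int \<Rightarrow> 'a::finite) measure"
    and K :: "(nat \<Rightarrow> 'a) \<Rightarrow> (nat \<Rightarrow> 'a) measure"
    and M :: "((nat \<Rightarrow> 'a) set, 'a) hmm"
  assumes "stationary_process P"
    and "future_kernel P K"
    and "M = eps_machine P K"
    and "finite_state_eps_machine P K"
  shows "markov_order P = sync_order M"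
proof -
  interpret causal_process P K
    by unfold_locales fact+
  \<comment> \<open>Both orders are infima over the same set of lengths, which includes the case
    where that set is empty and both are \<infinity>.\<close>
  show ?thesis
    by (simp add: markov_order_def sync_order_def markov_at_iff_sync assms(3))
qed

end
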